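(* Let $E$ be an $L^0(\mathcal{F})$-module with the countable concatenation property. Then: (1) Let $f:E\to\bar L^0(\mathcal{F})$ have the local property and $x=\sum_{n=1}^\infty\tilde I_{A_n}x_n$ for some countable partition $\{A_n,n\in\mathbb{N}\}$ of $\Omega$ to $\mathcal{F}$ and some sequence $\{x_n,n\in\mathbb{N}\}$ in $E$; then $f(x)=\sum_{n=1}^\infty\tilde I_{A_n}f(x_n)$. (2) Let $f:E\to\bar L^0(\mathcal{F})$ have the local property and $G\subset E$ be a nonempty subset; then $\bigvee\{f(x):x\in G\}=\bigvee\{f(x):x\in H_{cc}(G)\}$. (3) Let $f$ and $g$ be any two functions from $E$ to $\bar L^0(\mathcal{F})$ both having the local property and $G\subset E$ a nonempty subset. If $f(x)=g(x)$ for all $x\in G$, then $f(x)=g(x)$ for all $x\in H_{cc}(G)$. (4) Let $\{f_\alpha,\alpha\in\Gamma\}$ be a family of functions from $E$ to $\bar L^0(\mathcal{F})$ such that each $f_\alpha$ has the local property; then $f:E\to\bar L^0(\mathcal{F})$ defined by $f(x)=\bigvee\{f_\alpha(x):\alpha\in\Gamma\}$ for all $x\in E$ also has the local property.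
   Context: $(\Omega,\mathcal{F},P)$ is a probability space. $L^0(\mathcal{F})$ (resp. $\bar L^0(\mathcal{F})$) is the set of equivalence classes (a.s. equality) of real (resp. extended real)-valued $\mathcal{F}$-measurable random variables, with the a.s. order; $\bar L^0(\mathcal{F})$ is a complete lattice with suprema $\bigvee$. $\tilde I_A$ is the class of the indicator of $A\in\mathcal{F}$. Convention: $0\cdot(\pm\infty)=0$; for a countable partition $\{A_n\}$ and $\eta_n\in\bar L^0(\mathcal{F})$, $\sum_n\tilde I_{A_n}\eta_n$ is the element of $\bar L^0(\mathcal{F})$ equal to $\eta_n$ on $A_n$ for each $n$. A countable partition $\{A_n,n\in\mathbb{N}\}$ of $\Omega$ to $\mathcal{F}$ is a sequence of pairwise disjoint members of $\mathcal{F}$ with union $\Omega$. Standing assumption on every $L^0(\mathcal{F})$-module $E$: if $x,y\in E$ and there is a countable partition $\{A_n\}$ of $\Omega$ to $\mathcal{F}$ with $\tilde I_{A_n}x=\tilde I_{A_n}y$ for all $n$, then $x=y$. $E$ has the countable concatenation property if for each sequence $\{x_n\}$ in $E$ and each countable partition $\{A_n\}$ there is $x\in E$ with $\tilde I_{A_n}x=\tilde I_{A_n}x_n$ for all $n$; this (unique) $x$ is denoted $\sum_{n=1}^\infty\tilde I_{A_n}x_n$. For $G\subset E$, $H_{cc}(G)=\{\sum_{n=1}^\infty\tilde I_{A_n}g_n:\{A_n\}$ a countable partition of $\Omega$ to $\mathcal{F}$, $\{g_n\}$ a sequence in $G\}$. $f:E\to\bar L^0(\mathcal{F})$ has the local property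 (is local) if $\tilde I_Af(x)=\tilde I_Af(\tilde I_Ax)$ for all $x\in E$ and $A\in\mathcal{F}$. *)

theory Defs
  imports "HOL-Probability.Probability" "HOL-Algebra.Module" "HOL-Algebra.Complete_Lattice"
begin

section \<open>Equivalence classes of random variables\<close>

definition ae_class :: "'w measure \<Rightarrow> ('w \<Rightarrow> 'b::topological_space) \<Rightarrow> ('w \<Rightarrow> 'b) set" where
  "ae_class M f = {g \<in> borel_measurable M. AE w in M. g w = f w}"

text \<open>The class of the pointwise combination of representatives of the classes \<open>X\<close> and \<open>Y\<close>.\<close>

definition ae_lift2 ::
  "'w measure \<Rightarrow> ('a \<Rightarrow> 'b \<Rightarrow> 'c::topological_space) \<Rightarrow> ('w \<Rightarrow> 'a) set \<Rightarrow> ('w \<Rightarrow> 'b) set \<Rightarrow> ('w \<Rightarrow> 'c) set"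
  where "ae_lift2 M op X Y =
    {h \<in> borel_measurable M. \<exists>f\<in>X. \<exists>g\<in>Y. AE w in M. h w = op (f w) (g w)}"

definition L0 :: "'w measure \<Rightarrow> ('w \<Rightarrow> real) set ring" where
  "L0 M = \<lparr>carrier = ae_class M ` borel_measurable M,
           mult = ae_lift2 M (*),
           one = ae_class M (\<lambda>_. 1),
           zero = ae_class M (\<lambda>_. 0),
           add = ae_lift2 M (+)\<rparr>"

definition L0_bar :: "'w measure \<Rightarrow> ('w \<Rightarrow> ereal) set gorder" where
  "L0_bar M = \<lparr>carrier = ae_class M ` borel_measurable M,
               eq = (=),
               le = (\<lambda>X Y. \<exists>f\<in>X. \<exists>g\<in>Y. AE w in M. f w \<le> g w)\<rparr>"

definition ind_class :: "'w measure \<Rightarrow> 'w set \<Rightarrow> ('w \<Rightarrow> real) set" where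
  "ind_class M A = ae_class M (indicator A)"

text \<open>Product of a class in \<^term>\<open>L0 M\<close> with a class in \<^term>\<open>L0_bar M\<close>; multiplication on
  \<^typ>\<open>ereal\<close> satisfies \<open>0 * \<infinity> = 0\<close> and \<open>0 * (- \<infinity>) = 0\<close>.\<close>

definition smult_bar :: "'w measure \<Rightarrow> ('w \<Rightarrow> real) set \<Rightarrow> ('w \<Rightarrow> ereal) set \<Rightarrow> ('w \<Rightarrow> ereal) set" where
  "smult_bar M = ae_lift2 M (\<lambda>r y. ereal r * y)"

definition countable_partition :: "'w measure \<Rightarrow> (nat \<Rightarrow> 'w set) \<Rightarrow> bool" where
  "countable_partition M A \<longleftrightarrow>
     range A \<subseteq> sets M \<and> disjoint_family A \<and> (\<Union>n. A n) = space M"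

text \<open>The element \<open>\<Sum>\<^sub>n 1\<^bsub>A n\<^esub> \<eta>\<^sub>n\<close> of \<^term>\<open>L0_bar M\<close>: the class of the random variables that
  agree with \<open>\<eta> n\<close> on \<open>A n\<close> for every \<open>n\<close>.\<close>

definition concat_bar ::
  "'w measure \<Rightarrow> (nat \<Rightarrow> 'w set) \<Rightarrow> (nat \<Rightarrow> ('w \<Rightarrow> ereal) set) \<Rightarrow> ('w \<Rightarrow> ereal) set" where
  "concat_bar M A \<eta> =
     {h \<in> borel_measurable M. \<forall>n. \<exists>g\<in>\<eta> n. AE w in M. w \<in> A n \<longrightarrow> h w = g w}"


section \<open>Modules over \<open>L\<^sup>0\<close>\<close>

locale L0_module = prob_space M + Module.module "L0 M" E
  for M :: "'w measure" and E :: "(('w \<Rightarrow> real) set, 'e, 'x) module_scheme" +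
  assumes eq_if_eq_on_partition:
    "\<lbrakk>x \<in> carrier E; y \<in> carrier E; countable_partition M A;
      \<And>n. ind_class M (A n) \<odot>\<^bsub>E\<^esub> x = ind_class M (A n) \<odot>\<^bsub>E\<^esub> y\<rbrakk> \<Longrightarrow> x = y"

definition countable_concatenation ::
  "'w measure \<Rightarrow> (('w \<Rightarrow> real) set, 'e, 'x) module_scheme \<Rightarrow> bool" where
  "countable_concatenation M E \<longleftrightarrow>
     (\<forall>xs A. range xs \<subseteq> carrier E \<and> countable_partition M A \<longrightarrow>
       (\<exists>x\<in>carrier E. \<forall>n. ind_class M (A n) \<odot>\<^bsub>E\<^esub> x = ind_class M (A n) \<odot>\<^bsub>E\<^esub> xs n))"

text \<open>The element \<open>\<Sum>\<^sub>n 1\<^bsub>A n\<^esub> x\<^sub>n\<close> of \<open>E\<close>; it exists by the countable concatenation property and is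
  unique by \<open>eq_if_eq_on_partition\<close>.\<close>

definition concat_module ::
  "'w measure \<Rightarrow> (('w \<Rightarrow> real) set, 'e, 'x) module_scheme \<Rightarrow> (nat \<Rightarrow> 'w set) \<Rightarrow> (nat \<Rightarrow> 'e) \<Rightarrow> 'e"
  where "concat_module M E A xs =
    (THE x. x \<in> carrier E \<and>
      (\<forall>n. ind_class M (A n) \<odot>\<^bsub>E\<^esub> x = ind_class M (A n) \<odot>\<^bsub>E\<^esub> xs n))"

definition Hcc :: "'w measure \<Rightarrow> (('w \<Rightarrow> real) set, 'e, 'x) module_scheme \<Rightarrow> 'e set \<Rightarrow> 'e set" where
  "Hcc M E G = {concat_module M E A g | A g. countable_partition M A \<and> range g \<subseteq> G}"

definition local_property ::
  "'w measure \<Rightarrow> (('w \<Rightarrow> real) set, 'e, 'x) module_scheme \<Rightarrow> ('e \<Rightarrow> ('w \<Rightarrow> ereal) set) \<Rightarrow> bool" where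
  "local_property M E f \<longleftrightarrow>
     (\<forall>x\<in>carrier E. \<forall>A\<in>sets M.
       smult_bar M (ind_class M A) (f x) =
       smult_bar M (ind_class M A) (f (ind_class M A \<odot>\<^bsub>E\<^esub> x)))"

section \<open>Basic structure of \<open>L\<^sup>0\<close> and of its extended version\<close>

lemma ae_class_eq_iff:
  assumes "f \<in> borel_measurable M"
  shows "ae_class M f = ae_class M g \<longleftrightarrow> (AE w in M. f w = g w)"
proof
  assume "ae_class M f = ae_class M g"
  moreover have "f \<in> ae_class M f" using assms by (simp add: ae_class_def)
  ultimately show "AE w in M. f w = g w" by (simp add: ae_class_def)
next
  assume eq: "AE w in M. f w = g w"
  have "(AE w in M. h w = f w) \<longleftrightarrow> (AE w in M. h w = g w)" for h
    using eq by (auto elim: AE_mp)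
  then show "ae_class M f = ae_class M g" by (simp add: ae_class_def)
qed

lemma ae_lift2_ae_class:
  assumes f: "f \<in> borel_measurable M" and g: "g \<in> borel_measurable M"
  shows "ae_lift2 M op (ae_class M f) (ae_class M g) = ae_class M (\<lambda>w. op (f w) (g w))"
proof (intro equalityI subsetI)
  fix h assume "h \<in> ae_lift2 M op (ae_class M f) (ae_class M g)"
  then obtain f' g' where h: "h \<in> borel_measurable M" "AE w in M. f' w = f w" "AE w in M. g' w = g w"
    "AE w in M. h w = op (f' w) (g' w)"
    by (auto simp: ae_lift2_def ae_class_def)
  from h(2-4) have "AE w in M. h w = op (f w) (g w)" by eventually_elim simp
  with h(1) show "h \<in> ae_class M (\<lambda>w. op (f w) (g w))" by (simp add: ae_class_def)
next
  fix h assume "h \<in> ae_class M (\<lambda>w. op (f w) (g w))"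
  then show "h \<in> ae_lift2 M op (ae_class M f) (ae_class M g)"
    using f g by (auto simp: ae_lift2_def ae_class_def)
qed

lemma L0_bar_le_iff:
  assumes "f \<in> borel_measurable M" "g \<in> borel_measurable M"
  shows "ae_class M f \<sqsubseteq>\<^bsub>L0_bar M\<^esub> ae_class M g \<longleftrightarrow> (AE w in M. f w \<le> g w)"
proof
  assume "ae_class M f \<sqsubseteq>\<^bsub>L0_bar M\<^esub> ae_class M g"
  then obtain f' g' where h: "AE w in M. f' w = f w" "AE w in M. g' w = g w"
    "AE w in M. f' w \<le> g' w"
    by (auto simp: L0_bar_def ae_class_def)
  from h show "AE w in M. f w \<le> g w" by eventually_elim simp
qed (use assms in \<open>auto simp: L0_bar_def ae_class_def\<close>)

lemma cring_L0: "cring (L0 M)"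
proof (rule cringI)
  show "abelian_group (L0 M)"
  proof (rule abelian_groupI)
    fix x assume "x \<in> carrier (L0 M)"
    then obtain f where f: "f \<in> borel_measurable M" "x = ae_class M f" by (auto simp: L0_def)
    show "\<exists>y\<in>carrier (L0 M). y \<oplus>\<^bsub>L0 M\<^esub> x = \<zero>\<^bsub>L0 M\<^esub>"
      by (rule bexI[of _ "ae_class M (\<lambda>w. - f w)"]) (use f in \<open>auto simp: L0_def ae_lift2_ae_class\<close>)
  qed (auto simp: L0_def ae_lift2_ae_class algebra_simps)
  show "comm_monoid (L0 M)"
    by (rule comm_monoidI) (auto simp: L0_def ae_lift2_ae_class algebra_simps)
qed (auto simp: L0_def ae_lift2_ae_class algebra_simps)

lemma partial_order_L0_bar: "partial_order (L0_bar M)"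
proof
  show "x \<sqsubseteq>\<^bsub>L0_bar M\<^esub> x" if "x \<in> carrier (L0_bar M)" for x
  proof -
    from that obtain f where "f \<in> borel_measurable M" "x = ae_class M f" by (auto simp: L0_bar_def)
    then show ?thesis by (simp add: L0_bar_le_iff)
  qed
next
  fix x y assume "x \<sqsubseteq>\<^bsub>L0_bar M\<^esub> y" "y \<sqsubseteq>\<^bsub>L0_bar M\<^esub> x" "x \<in> carrier (L0_bar M)" "y \<in> carrier (L0_bar M)"
  moreover from this obtain f g where fg: "f \<in> borel_measurable M" "x = ae_class M f"
    "g \<in> borel_measurable M" "y = ae_class M g" by (auto simp: L0_bar_def)
  ultimately have "AE w in M. f w \<le> g w" "AE w in M. g w \<le> f w" by (simp_all add: L0_bar_le_iff)
  then have "AE w in M. f w = g w" by eventually_elim simp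
  with fg show "x .=\<^bsub>L0_bar M\<^esub> y" by (simp add: ae_class_eq_iff L0_bar_def)
next
  fix x y z assume "x \<sqsubseteq>\<^bsub>L0_bar M\<^esub> y" "y \<sqsubseteq>\<^bsub>L0_bar M\<^esub> z"
    "x \<in> carrier (L0_bar M)" "y \<in> carrier (L0_bar M)" "z \<in> carrier (L0_bar M)"
  moreover from this obtain f g h where fgh: "f \<in> borel_measurable M" "x = ae_class M f"
    "g \<in> borel_measurable M" "y = ae_class M g"
    "h \<in> borel_measurable M" "z = ae_class M h" by (auto simp: L0_bar_def)
  ultimately have "AE w in M. f w \<le> g w" "AE w in M. g w \<le> h w" by (simp_all add: L0_bar_le_iff)
  then have "AE w in M. f w \<le> h w" by eventually_elim simp
  with fgh show "x \<sqsubseteq>\<^bsub>L0_bar M\<^esub> z" by (simp add: L0_bar_le_iff)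
qed (auto simp: L0_bar_def)

text \<open>A bounded strictly increasing transformation of the extended reals.\<close>

definition ereal_arctan :: "ereal \<Rightarrow> real" where
  "ereal_arctan x = (if x = \<infinity> then 2 else if x = - \<infinity> then - 2 else arctan (real_of_ereal x))"

lemma strict_mono_ereal_arctan: "strict_mono ereal_arctan"
proof (rule strict_monoI)
  have pi: "\<bar>arctan y\<bar> < 2" for y
    using arctan_bounded[of y] pi_less_4 by linarith
  fix x y :: ereal assume "x < y"
  then show "ereal_arctan x < ereal_arctan y"
    using pi[of "real_of_ereal x"] pi[of "real_of_ereal y"]
    by (cases x; cases y) (auto simp: ereal_arctan_def arctan_less_iff)
qed

lemma abs_ereal_arctan_le: "\<bar>ereal_arctan x\<bar> \<le> 2"
  using arctan_bounded[of "real_of_ereal x"] pi_less_4 by (auto simp: ereal_arctan_def)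

lemma measurable_ereal_arctan [measurable]: "ereal_arctan \<in> borel_measurable borel"
  unfolding ereal_arctan_def by measurable

lemma (in prob_space) essential_supremum_exists:
  fixes F :: "('a \<Rightarrow> ereal) set"
  assumes F: "F \<subseteq> borel_measurable M"
  obtains g where "g \<in> borel_measurable M" "\<And>f. f \<in> F \<Longrightarrow> AE w in M. f w \<le> g w"
    "\<And>u. (\<And>f. f \<in> F \<Longrightarrow> AE w in M. f w \<le> u w) \<Longrightarrow> AE w in M. g w \<le> u w"
proof -
  define S where "S C w = (SUP f\<in>C. f w)" for C :: "('a \<Rightarrow> ereal) set" and w
  define I where "I C = expectation (\<lambda>w. ereal_arctan (S C w))" for C
  define K where "K = {C. countable C \<and> C \<subseteq> F}"
  have meas [measurable]: "S C \<in> borel_measurable M" if "C \<in> K" for C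
    unfolding S_def using that F by (intro borel_measurable_SUP) (auto simp: K_def)
  have int: "integrable M (\<lambda>w. ereal_arctan (S C w))" if "C \<in> K" for C
  proof (rule integrable_const_bound[of _ 2])
    show "(\<lambda>w. ereal_arctan (S C w)) \<in> borel_measurable M" using meas[OF that] by measurable
  qed (simp add: abs_ereal_arctan_le)
  have S_mono: "S C w \<le> S D w" if "C \<subseteq> D" for C D w
    unfolding S_def using that by (rule SUP_subset_mono) simp
  have phi_mono: "ereal_arctan x \<le> ereal_arctan y" if "x \<le> y" for x y
    using strict_mono_ereal_arctan that by (simp add: strict_mono_less_eq)
  have I_mono: "I C \<le> I D" if "C \<subseteq> D" "C \<in> K" "D \<in> K" for C D
    unfolding I_def using that by (intro integral_mono int phi_mono S_mono)
  have bdd: "bdd_above (I ` K)"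
  proof (rule bdd_aboveI2)
    fix C assume C: "C \<in> K"
    show "I C \<le> 2" unfolding I_def
      using integral_mono[OF int[OF C], of "\<lambda>_. 2"] abs_ereal_arctan_le
      by (simp add: abs_le_iff prob_space)
  qed
  have ne: "K \<noteq> {}" by (auto simp: K_def)
  define s where "s = (SUP C\<in>K. I C)"
  have "\<exists>C\<in>K. s - 1 / real (Suc n) < I C" for n
    using less_cSUP_iff[OF ne bdd, of "s - 1 / real (Suc n)"] by (simp add: s_def)
  then obtain C where C: "\<And>n. C n \<in> K" "\<And>n. s - 1 / real (Suc n) < I (C n)" by metis
  define D where "D = (\<Union>n. C n)"
  have D: "D \<in> K" using C(1) by (auto simp: D_def K_def)
  have "s - 1 / real (Suc n) \<le> I D" for n
    using C(2)[of n] I_mono[OF _ C(1) D, of n] by (force simp: D_def)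
  then have le: "s \<le> I D + 1 / real (Suc n)" for n
    by (simp add: algebra_simps)
  have sD: "s \<le> I D"
  proof (rule field_le_epsilon)
    fix e :: real assume "0 < e"
    then obtain n where "1 / real (Suc n) < e" using nat_approx_posE by blast
    with le[of n] show "s \<le> I D + e" by linarith
  qed
  show ?thesis
  proof (rule that[of "S D"])
    show "S D \<in> borel_measurable M" using D by (rule meas)
  next
    fix f assume f: "f \<in> F"
    let ?D = "insert f D"
    have D': "?D \<in> K" using D f by (auto simp: K_def)
    have "I ?D \<le> s" unfolding s_def using D' bdd by (intro cSUP_upper)
    moreover have "I D \<le> I ?D" using D D' by (intro I_mono) auto
    ultimately have eq: "I ?D = I D" using sD by linarith
    have "AE w in M. ereal_arctan (S ?D w) - ereal_arctan (S D w) = 0"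
    proof (subst integral_nonneg_eq_0_iff_AE[symmetric])
      show "integrable M (\<lambda>w. ereal_arctan (S ?D w) - ereal_arctan (S D w))"
        using int D D' by simp
      show "AE w in M. 0 \<le> ereal_arctan (S ?D w) - ereal_arctan (S D w)"
        by (intro AE_I2) (simp add: phi_mono S_mono subset_insertI)
      show "expectation (\<lambda>w. ereal_arctan (S ?D w) - ereal_arctan (S D w)) = 0"
        using eq int D D' by (simp add: I_def)
    qed
    then show "AE w in M. f w \<le> S D w"
    proof eventually_elim
      case (elim w)
      then have "S ?D w = S D w"
        using strict_mono_eq[OF strict_mono_ereal_arctan] by simp
      moreover have "f w \<le> S ?D w" unfolding S_def by (rule SUP_upper) simp
      ultimately show ?case by simp
    qed
  next
    fix u assume u: "\<And>f. f \<in> F \<Longrightarrow> AE w in M. f w \<le> u w"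
    have "AE w in M. \<forall>f\<in>D. f w \<le> u w"
      using D u by (subst AE_ball_countable) (auto simp: K_def)
    then show "AE w in M. S D w \<le> u w"
      by eventually_elim (auto simp: S_def intro: SUP_least)
  qed
qed

lemma (in prob_space) complete_lattice_L0_bar: "Complete_Lattice.complete_lattice (L0_bar M)"
proof -
  interpret L: partial_order "L0_bar M" by (rule partial_order_L0_bar)
  have sup: "\<exists>s. is_lub (L0_bar M) s A" if A: "A \<subseteq> carrier (L0_bar M)" for A
  proof -
    define F where "F = {f \<in> borel_measurable M. ae_class M f \<in> A}"
    have F: "F \<subseteq> borel_measurable M" by (auto simp: F_def)
    obtain g where g: "g \<in> borel_measurable M" "\<And>f. f \<in> F \<Longrightarrow> AE w in M. f w \<le> g w"
      "\<And>u. (\<And>f. f \<in> F \<Longrightarrow> AE w in M. f w \<le> u w) \<Longrightarrow> AE w in M. g w \<le> u w"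
      by (rule essential_supremum_exists[OF F]) blast
    have "is_lub (L0_bar M) (ae_class M g) A"
    proof (rule least_UpperI)
      fix x assume x: "x \<in> A"
      with A obtain f where f: "f \<in> borel_measurable M" "x = ae_class M f"
        by (auto simp: L0_bar_def)
      with x g show "x \<sqsubseteq>\<^bsub>L0_bar M\<^esub> ae_class M g" by (simp add: L0_bar_le_iff F_def)
    next
      fix y assume y: "y \<in> Upper (L0_bar M) A"
      then obtain u where u: "u \<in> borel_measurable M" "y = ae_class M u"
        by (auto simp: L0_bar_def Upper_def)
      have "AE w in M. f w \<le> u w" if "f \<in> F" for f
        using y u that A by (auto simp: Upper_def F_def L0_bar_le_iff[symmetric])
      with g u show "ae_class M g \<sqsubseteq>\<^bsub>L0_bar M\<^esub> y" by (simp add: L0_bar_le_iff)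
    qed (use A g(1) in \<open>auto simp: L0_bar_def\<close>)
    then show ?thesis ..
  qed
  show ?thesis
  proof
    fix A assume A: "A \<subseteq> carrier (L0_bar M)"
    show "\<exists>s. is_lub (L0_bar M) s A" by (rule sup[OF A])
    obtain i where i: "is_lub (L0_bar M) i (Lower (L0_bar M) A)"
      using sup[OF Lower_closed] by blast
    have "is_glb (L0_bar M) i A"
    proof (rule greatest_LowerI)
      show "i \<sqsubseteq>\<^bsub>L0_bar M\<^esub> x" if "x \<in> A" for x
        using that A i by (intro least_le[OF i]) (auto simp: Upper_def Lower_def)
      show "y \<sqsubseteq>\<^bsub>L0_bar M\<^esub> i" if "y \<in> Lower (L0_bar M) A" for y
        using least_Upper_above[OF i that] by simp
    qed (use A least_closed[OF i] in auto)
    then show "\<exists>i. is_glb (L0_bar M) i A" ..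
  qed
qed

end

theory Submission
  imports Defs
begin

text \<open>Everything is localised: two classes have the same product with the indicator of \<open>A\<close> iff
  their representatives agree almost everywhere on \<open>A\<close>. Suprema respect this: raising one supremum
  to \<open>\<infinity>\<close> off \<open>A\<close> turns it into an upper bound of any family that agrees on \<open>A\<close> with the given one.
  Passing to \<open>Hcc\<close> preserves suprema because it does not even change the set of upper bounds.\<close>

section \<open>Representatives, indicators and gluing over a countable partition\<close>

lemma L0_bar_carrierE:
  assumes "X \<in> carrier (L0_bar M)"
  obtains f where "f \<in> borel_measurable M" "X = ae_class M f"
  using assms by (auto simp: L0_bar_def)

lemma ae_class_in_L0_bar: "f \<in> borel_measurable M \<Longrightarrow> ae_class M f \<in> carrier (L0_bar M)"
  by (simp add: L0_bar_def)

lemma ind_class_in_L0: "A \<in> sets M \<Longrightarrow> ind_class M A \<in> carrier (L0 M)"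
  by (simp add: L0_def ind_class_def)

text \<open>Multiplication by the indicator keeps the value on \<open>A\<close> and yields 0 off
  \<open>A\<close>, even at infinite values. This translates locality, an equation between products
  of classes, into almost sure statements on \<open>A\<close>.\<close>

lemma smult_bar_ind_class_eq_iff:
  assumes "A \<in> sets M" "f \<in> borel_measurable M" "g \<in> borel_measurable M"
  shows "smult_bar M (ind_class M A) (ae_class M f) = smult_bar M (ind_class M A) (ae_class M g) \<longleftrightarrow>
    (AE w in M. w \<in> A \<longrightarrow> f w = g w)"
proof -
  have "(ereal (indicator A w) * f w = ereal (indicator A w) * g w) \<longleftrightarrow> (w \<in> A \<longrightarrow> f w = g w)" for w
    \<comment> \<open>Folding \<open>ereal 1\<close> and \<open>ereal 0\<close> back to
      \<open>1\<close> and \<open>0\<close> exposes the unit and zero laws of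
      \<open>ereal\<close>.\<close>
    by (cases "w \<in> A") (auto simp: one_ereal_def[symmetric] zero_ereal_def[symmetric])
  then show ?thesis
    using assms by (simp add: smult_bar_def ind_class_def ae_lift2_ae_class ae_class_eq_iff)
qed

text \<open>A countable union of null sets is null, and the cells cover \<open>space M\<close>. This
  glues cellwise statements together.\<close>

lemma AE_countable_partition:
  assumes "countable_partition M A" "\<And>n. AE w in M. w \<in> A n \<longrightarrow> P w"
  shows "AE w in M. P w"
proof -
  have "AE w in M. \<forall>n. w \<in> A n \<longrightarrow> P w" using assms(2) by (subst AE_all_countable) blast
  then show ?thesis
    using AE_space by eventually_elim (use assms(1) in \<open>auto simp: countable_partition_def\<close>)
qed

text \<open>Since \<open>concat_bar\<close> is a raw set of random variables, the claim is an
  equality of sets. One inclusion restricts a member of \<open>X\<close> to each cell; the other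
  glues the cellwise agreement with a representative of \<open>X\<close>.\<close>

lemma eq_concat_bar:
  assumes A: "countable_partition M A"
    and X: "X \<in> carrier (L0_bar M)" and Y: "\<And>n. Y n \<in> carrier (L0_bar M)"
    and eq: "\<And>n. smult_bar M (ind_class M (A n)) X = smult_bar M (ind_class M (A n)) (Y n)"
  shows "X = concat_bar M A Y"
proof -
  obtain f where f: "f \<in> borel_measurable M" "X = ae_class M f" using X by (rule L0_bar_carrierE)
  have "\<exists>g. g \<in> borel_measurable M \<and> Y n = ae_class M g" for n
    using Y[of n] by (auto elim: L0_bar_carrierE)
  then obtain g where g: "\<And>n. g n \<in> borel_measurable M" "\<And>n. Y n = ae_class M (g n)" by metis
  have An: "A n \<in> sets M" for n using A by (auto simp: countable_partition_def)
  have fg: "AE w in M. w \<in> A n \<longrightarrow> f w = g n w" for n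
    using eq[of n] An f g by (simp add: smult_bar_ind_class_eq_iff)
  show ?thesis
  proof (intro equalityI subsetI)
    fix h assume "h \<in> X"
    then have h: "h \<in> borel_measurable M" "AE w in M. h w = f w" by (auto simp: f ae_class_def)
    have "AE w in M. w \<in> A n \<longrightarrow> h w = g n w" for n
      using fg[of n] h(2) by eventually_elim simp
    moreover have "g n \<in> Y n" for n using g by (simp add: ae_class_def)
    ultimately show "h \<in> concat_bar M A Y" using h(1) by (auto simp: concat_bar_def)
  next
    fix h assume "h \<in> concat_bar M A Y"
    then have h: "h \<in> borel_measurable M" "\<And>n. \<exists>k\<in>Y n. AE w in M. w \<in> A n \<longrightarrow> h w = k w"
      by (auto simp: concat_bar_def)
    have "AE w in M. w \<in> A n \<longrightarrow> h w = f w" for n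
    proof -
      \<comment> \<open>The witness \<open>k\<close> is an arbitrary member of \<open>Y n\<close>
        that may change with \<open>n\<close> and \<open>h\<close>; it is compared with
        \<open>f\<close> through the fixed representative \<open>g n\<close>.\<close>
      obtain k where "AE w in M. w \<in> A n \<longrightarrow> h w = k w" "AE w in M. k w = g n w"
        using h(2)[of n] g by (auto simp: ae_class_def)
      then show ?thesis using fg[of n] by eventually_elim simp
    qed
    then have "AE w in M. h w = f w" by (rule AE_countable_partition[OF A])
    with h(1) show "h \<in> X" by (simp add: f ae_class_def)
  qed
qed

section \<open>Suprema restricted to a measurable set\<close>

context prob_space
begin

text \<open>One half of the agreement of the two suprema on \<open>A\<close>, stated for
  representatives so that it can be applied again with \<open>F\<close> and \<open>G\<close>
  exchanged.\<close>

lemma sup_le_on: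
  assumes A: "A \<in> sets M"
    and F: "\<And>i. i \<in> I \<Longrightarrow> F i \<in> carrier (L0_bar M)"
    and G: "\<And>i. i \<in> I \<Longrightarrow> G i \<in> carrier (L0_bar M)"
    and eq: "\<And>i. i \<in> I \<Longrightarrow>
      smult_bar M (ind_class M A) (F i) = smult_bar M (ind_class M A) (G i)"
    and f: "f \<in> borel_measurable M" "\<Squnion>\<^bsub>L0_bar M\<^esub> (F ` I) = ae_class M f"
    and g: "g \<in> borel_measurable M" "\<Squnion>\<^bsub>L0_bar M\<^esub> (G ` I) = ae_class M g"
  shows "AE w in M. w \<in> A \<longrightarrow> f w \<le> g w"
proof -
  interpret L: Complete_Lattice.complete_lattice "L0_bar M" by (rule complete_lattice_L0_bar)
  \<comment> \<open>Off \<open>A\<close> nothing relates \<open>F i\<close> to \<open>G i\<close>,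
    and the value \<infinity> makes the bound trivial there; on \<open>A\<close> the bound is still
    \<open>g\<close>.\<close>
  define u where "u w = (if w \<in> A then g w else \<infinity>)" for w
  have u: "u \<in> borel_measurable M" unfolding u_def using A g(1) by measurable
  have "\<Squnion>\<^bsub>L0_bar M\<^esub> (F ` I) \<sqsubseteq>\<^bsub>L0_bar M\<^esub> ae_class M u"
  proof (rule L.sup_least)
    fix X assume "X \<in> F ` I"
    then obtain i where i: "i \<in> I" "X = F i" by auto
    obtain h where h: "h \<in> borel_measurable M" "F i = ae_class M h"
      using F[OF i(1)] by (rule L0_bar_carrierE)
    obtain k where k: "k \<in> borel_measurable M" "G i = ae_class M k"
      using G[OF i(1)] by (rule L0_bar_carrierE)
    have "G i \<sqsubseteq>\<^bsub>L0_bar M\<^esub> \<Squnion>\<^bsub>L0_bar M\<^esub> (G ` I)" using G i(1) by (intro L.sup_upper) auto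
    then have "AE w in M. k w \<le> g w" using g k by (simp add: L0_bar_le_iff)
    moreover have "AE w in M. w \<in> A \<longrightarrow> h w = k w"
      using eq[OF i(1)] A h k by (simp add: smult_bar_ind_class_eq_iff)
    ultimately have "AE w in M. h w \<le> u w" by eventually_elim (auto simp: u_def)
    then show "X \<sqsubseteq>\<^bsub>L0_bar M\<^esub> ae_class M u" using i h u by (simp add: L0_bar_le_iff)
  qed (use F u in \<open>auto intro: ae_class_in_L0_bar\<close>)
  then have "AE w in M. f w \<le> u w" using f u by (simp add: L0_bar_le_iff)
  then show ?thesis by eventually_elim (auto simp: u_def)
qed

text \<open>For uncountable \<open>I\<close> the supremum need not be a pointwise supremum of
  representatives, so the indicator cannot simply be moved inside. The argument uses the order
  instead: \<open>sup_le_on\<close> gives both inequalities on \<open>A\<close>.\<close>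

lemma smult_bar_sup_cong:
  assumes A: "A \<in> sets M"
    and F: "\<And>i. i \<in> I \<Longrightarrow> F i \<in> carrier (L0_bar M)"
    and G: "\<And>i. i \<in> I \<Longrightarrow> G i \<in> carrier (L0_bar M)"
    and eq: "\<And>i. i \<in> I \<Longrightarrow>
      smult_bar M (ind_class M A) (F i) = smult_bar M (ind_class M A) (G i)"
  shows "smult_bar M (ind_class M A) (\<Squnion>\<^bsub>L0_bar M\<^esub> (F ` I)) =
    smult_bar M (ind_class M A) (\<Squnion>\<^bsub>L0_bar M\<^esub> (G ` I))"
proof -
  interpret L: Complete_Lattice.complete_lattice "L0_bar M" by (rule complete_lattice_L0_bar)
  obtain f where f: "f \<in> borel_measurable M" "\<Squnion>\<^bsub>L0_bar M\<^esub> (F ` I) = ae_class M f"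
    using F by (elim L0_bar_carrierE[OF L.sup_closed, OF image_subsetI])
  obtain g where g: "g \<in> borel_measurable M" "\<Squnion>\<^bsub>L0_bar M\<^esub> (G ` I) = ae_class M g"
    using G by (elim L0_bar_carrierE[OF L.sup_closed, OF image_subsetI])
  have "AE w in M. w \<in> A \<longrightarrow> f w \<le> g w" using A F G eq f g by (rule sup_le_on)
  moreover have "AE w in M. w \<in> A \<longrightarrow> g w \<le> f w" using A G F eq[symmetric] g f by (rule sup_le_on)
  ultimately have "AE w in M. w \<in> A \<longrightarrow> f w = g w" by eventually_elim auto
  then show ?thesis using A f g by (simp add: smult_bar_ind_class_eq_iff)
qed

end

section \<open>Local functions, concatenations and \<open>Hcc\<close>\<close>

context L0_module
begin

text \<open>By locality, \<open>f x\<close> and \<open>f y\<close> both agree on \<open>A\<close>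
  with the value of \<open>f\<close> at the common indicator multiple of \<open>x\<close> and
  \<open>y\<close>.\<close>

lemma local_property_cong:
  assumes "local_property M E f" "A \<in> sets M" "x \<in> carrier E" "y \<in> carrier E"
    and "ind_class M A \<odot>\<^bsub>E\<^esub> x = ind_class M A \<odot>\<^bsub>E\<^esub> y"
  shows "smult_bar M (ind_class M A) (f x) = smult_bar M (ind_class M A) (f y)"
  using assms unfolding local_property_def by metis

text \<open>The axiom \<open>eq_if_eq_on_partition\<close> supplies the uniqueness that evaluates
  the definite description; existence is witnessed by \<open>x\<close>.\<close>

lemma concat_module_eqI:
  assumes "countable_partition M A" "x \<in> carrier E"
    and "\<And>n. ind_class M (A n) \<odot>\<^bsub>E\<^esub> x = ind_class M (A n) \<odot>\<^bsub>E\<^esub> xs n"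
  shows "concat_module M E A xs = x"
  unfolding concat_module_def
  by (rule the_equality) (use assms in \<open>auto intro: eq_if_eq_on_partition[OF _ _ assms(1)]\<close>)

lemma concat_module_props:
  assumes "countable_concatenation M E" "countable_partition M A" "range xs \<subseteq> carrier E"
  shows "concat_module M E A xs \<in> carrier E"
    and "ind_class M (A n) \<odot>\<^bsub>E\<^esub> concat_module M E A xs = ind_class M (A n) \<odot>\<^bsub>E\<^esub> xs n"
proof -
  obtain x where "x \<in> carrier E"
    "\<And>n. ind_class M (A n) \<odot>\<^bsub>E\<^esub> x = ind_class M (A n) \<odot>\<^bsub>E\<^esub> xs n"
    using assms unfolding countable_concatenation_def by blast
  with concat_module_eqI[OF assms(2)] show "concat_module M E A xs \<in> carrier E"
    "ind_class M (A n) \<odot>\<^bsub>E\<^esub> concat_module M E A xs = ind_class M (A n) \<odot>\<^bsub>E\<^esub> xs n"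
    by auto
qed

text \<open>On the cell \<open>A n\<close> the concatenation and \<open>xs n\<close> have the same
  indicator multiple, so \<open>local_property_cong\<close> applies; \<open>eq_concat_bar\<close>
  then assembles the cells. The cellwise form is kept for comparing upper bounds in
  \<open>Upper_image_Hcc\<close>.\<close>

lemma local_concat_module:
  assumes E: "countable_concatenation M E"
    and f: "f \<in> carrier E \<rightarrow> carrier (L0_bar M)" "local_property M E f"
    and A: "countable_partition M A" and xs: "range xs \<subseteq> carrier E"
  shows "smult_bar M (ind_class M (A n)) (f (concat_module M E A xs)) =
      smult_bar M (ind_class M (A n)) (f (xs n))"
    and "f (concat_module M E A xs) = concat_bar M A (\<lambda>n. f (xs n))"
proof -
  show agree: "smult_bar M (ind_class M (A n)) (f (concat_module M E A xs)) =
      smult_bar M (ind_class M (A n)) (f (xs n))" for n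
    using concat_module_props[OF E A xs] A xs
    by (intro local_property_cong[OF f(2)]) (auto simp: countable_partition_def)
  show "f (concat_module M E A xs) = concat_bar M A (\<lambda>n. f (xs n))"
    using f(1) xs concat_module_props(1)[OF E A xs]
    by (intro eq_concat_bar[OF A] agree) (auto simp: image_subset_iff)
qed

lemma subset_Hcc:
  assumes G: "G \<subseteq> carrier E"
  shows "G \<subseteq> Hcc M E G"
proof
  fix x assume x: "x \<in> G"
  \<comment> \<open>Partitions are indexed by all naturals, so the trivial one is padded with empty
    cells; a constant sequence concatenates to its value.\<close>
  define A where "A n = (if n = 0 then space M else {})" for n :: nat
  have A: "countable_partition M A"
    by (auto simp: countable_partition_def A_def disjoint_family_on_def)
  then have "concat_module M E A (\<lambda>_. x) = x" using x G by (intro concat_module_eqI) auto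
  then show "x \<in> Hcc M E G" unfolding Hcc_def using A x by force
qed

text \<open>On each cell the value of \<open>f\<close> at a concatenation is its value at some
  element of \<open>G\<close>, hence below any upper bound for \<open>G\<close>; gluing the cells
  gives the inequality almost surely.\<close>

lemma Upper_image_Hcc:
  assumes E: "countable_concatenation M E"
    and f: "f \<in> carrier E \<rightarrow> carrier (L0_bar M)" "local_property M E f"
    and G: "G \<subseteq> carrier E"
  shows "Upper (L0_bar M) (f ` Hcc M E G) = Upper (L0_bar M) (f ` G)"
proof
  show "Upper (L0_bar M) (f ` Hcc M E G) \<subseteq> Upper (L0_bar M) (f ` G)"
    using subset_Hcc[OF G] by (intro Upper_antimono image_mono)
next
  show "Upper (L0_bar M) (f ` G) \<subseteq> Upper (L0_bar M) (f ` Hcc M E G)"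
  proof
    fix U assume U: "U \<in> Upper (L0_bar M) (f ` G)"
    then have "U \<in> carrier (L0_bar M)" by (simp add: Upper_def)
    then obtain u where u: "u \<in> borel_measurable M" "U = ae_class M u" by (rule L0_bar_carrierE)
    have Hcc: "f x \<sqsubseteq>\<^bsub>L0_bar M\<^esub> U \<and> f x \<in> carrier (L0_bar M)" if "x \<in> Hcc M E G" for x
    proof -
      obtain A g where x: "x = concat_module M E A g"
        and A: "countable_partition M A" and g: "range g \<subseteq> G"
        using \<open>x \<in> Hcc M E G\<close> by (auto simp: Hcc_def)
      have gE: "range g \<subseteq> carrier E" using g G by blast
      have fx: "f x \<in> carrier (L0_bar M)"
        using f(1) concat_module_props(1)[OF E A gE] x by auto
      then obtain h where h: "h \<in> borel_measurable M" "f x = ae_class M h" by (rule L0_bar_carrierE)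
      have "AE w in M. w \<in> A n \<longrightarrow> h w \<le> u w" for n
      proof -
        have gn: "f (g n) \<in> carrier (L0_bar M)" using f(1) gE by (auto simp: image_subset_iff)
        then obtain k where k: "k \<in> borel_measurable M" "f (g n) = ae_class M k"
          by (rule L0_bar_carrierE)
        have "f (g n) \<sqsubseteq>\<^bsub>L0_bar M\<^esub> U" using U gn g by (auto simp: Upper_def)
        then have "AE w in M. k w \<le> u w" using k u by (simp add: L0_bar_le_iff)
        moreover have "A n \<in> sets M" using A by (auto simp: countable_partition_def)
        then have "AE w in M. w \<in> A n \<longrightarrow> h w = k w"
          using local_concat_module(1)[OF E f A gE, of n] h k x
          by (simp add: smult_bar_ind_class_eq_iff)
        ultimately show ?thesis by eventually_elim auto
      qed
      then have "AE w in M. h w \<le> u w" by (rule AE_countable_partition[OF A])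
      with fx h u show ?thesis by (simp add: L0_bar_le_iff)
    qed
    show "U \<in> Upper (L0_bar M) (f ` Hcc M E G)"
      using Hcc \<open>U \<in> carrier (L0_bar M)\<close> by (auto simp: Upper_def)
  qed
qed

text \<open>For fixed \<open>x\<close> and \<open>A\<close>, locality makes the values of each
  \<open>F \<alpha>\<close> at \<open>x\<close> and at its indicator multiple agree on
  \<open>A\<close>, and \<open>smult_bar_sup_cong\<close> carries this over to the suprema.\<close>

lemma local_property_sup:
  assumes F: "\<And>\<alpha>. \<alpha> \<in> \<Gamma> \<Longrightarrow> F \<alpha> \<in> carrier E \<rightarrow> carrier (L0_bar M)"
      "\<And>\<alpha>. \<alpha> \<in> \<Gamma> \<Longrightarrow> local_property M E (F \<alpha>)"
    and f: "\<And>x. x \<in> carrier E \<Longrightarrow> f x = \<Squnion>\<^bsub>L0_bar M\<^esub> ((\<lambda>\<alpha>. F \<alpha> x) ` \<Gamma>)"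
  shows "f \<in> carrier E \<rightarrow> carrier (L0_bar M)" and "local_property M E f"
proof -
  interpret L: Complete_Lattice.complete_lattice "L0_bar M" by (rule complete_lattice_L0_bar)
  have cl: "F \<alpha> x \<in> carrier (L0_bar M)" if "\<alpha> \<in> \<Gamma>" "x \<in> carrier E" for \<alpha> x
    using F(1) that by blast
  show "f \<in> carrier E \<rightarrow> carrier (L0_bar M)"
    using cl by (auto simp: f intro!: L.sup_closed)
  show "local_property M E f"
    unfolding local_property_def
  proof (intro ballI)
    fix x A assume x: "x \<in> carrier E" and A: "A \<in> sets M"
    \<comment> \<open>The formula for \<open>f\<close> is given on \<open>carrier E\<close> only, so
      the localised point must lie there before \<open>f\<close> can be unfolded at it.\<close>
    have y: "ind_class M A \<odot>\<^bsub>E\<^esub> x \<in> carrier E" using x A by (simp add: ind_class_in_L0)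
    show "smult_bar M (ind_class M A) (f x) =
      smult_bar M (ind_class M A) (f (ind_class M A \<odot>\<^bsub>E\<^esub> x))"
      unfolding f[OF x] f[OF y] using A
    proof (rule smult_bar_sup_cong)
      show "smult_bar M (ind_class M A) (F \<alpha> x) =
        smult_bar M (ind_class M A) (F \<alpha> (ind_class M A \<odot>\<^bsub>E\<^esub> x))" if "\<alpha> \<in> \<Gamma>" for \<alpha>
        using F(2)[OF that] x A by (auto simp: local_property_def)
    qed (use cl x y in auto)
  qed
qed

end

theorem lemma5p7:
  fixes M :: "'w measure"
    and E :: "(('w \<Rightarrow> real) set, 'e, 'x) module_scheme"
  assumes "L0_module M E"
    and "countable_concatenation M E"
  shows
    "(\<forall>f A xs x.
        f \<in> carrier E \<rightarrow> carrier (L0_bar M) \<and> local_property M E f \<and>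
        countable_partition M A \<and> range xs \<subseteq> carrier E \<and> x = concat_module M E A xs
        \<longrightarrow> f x = concat_bar M A (\<lambda>n. f (xs n)))
   \<and> (\<forall>f G.
        f \<in> carrier E \<rightarrow> carrier (L0_bar M) \<and> local_property M E f \<and>
        G \<subseteq> carrier E \<and> G \<noteq> {}
        \<longrightarrow> \<Squnion>\<^bsub>L0_bar M\<^esub> (f ` G) = \<Squnion>\<^bsub>L0_bar M\<^esub> (f ` Hcc M E G))
   \<and> (\<forall>f g G.
        f \<in> carrier E \<rightarrow> carrier (L0_bar M) \<and> local_property M E f \<and>
        g \<in> carrier E \<rightarrow> carrier (L0_bar M) \<and> local_property M E g \<and>
        G \<subseteq> carrier E \<and> G \<noteq> {} \<and> (\<forall>x\<in>G. f x = g x)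
        \<longrightarrow> (\<forall>x\<in>Hcc M E G. f x = g x))
   \<and> (\<forall>(\<Gamma> :: 'i set) F f.
        (\<forall>\<alpha>\<in>\<Gamma>. F \<alpha> \<in> carrier E \<rightarrow> carrier (L0_bar M) \<and> local_property M E (F \<alpha>)) \<and>
        (\<forall>x\<in>carrier E. f x = \<Squnion>\<^bsub>L0_bar M\<^esub> {F \<alpha> x | \<alpha>. \<alpha> \<in> \<Gamma>})
        \<longrightarrow> f \<in> carrier E \<rightarrow> carrier (L0_bar M) \<and> local_property M E f)"
proof -
  interpret L0_module M E by fact
  note cc = assms(2)
  show ?thesis
  proof (intro conjI allI impI; (elim conjE)?)
    fix f A xs x
    assume "f \<in> carrier E \<rightarrow> carrier (L0_bar M)" "local_property M E f"
      "countable_partition M A" "range xs \<subseteq> carrier E" "x = concat_module M E A xs"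
    then show "f x = concat_bar M A (\<lambda>n. f (xs n))" using local_concat_module(2)[OF cc] by blast
  next
    fix f G
    assume "f \<in> carrier E \<rightarrow> carrier (L0_bar M)" "local_property M E f" "G \<subseteq> carrier E"
    \<comment> \<open>A supremum in \<open>L0_bar M\<close> is by definition a chosen least element
      of \<open>Upper\<close>, so equal sets of upper bounds give equal suprema.\<close>
    then show "\<Squnion>\<^bsub>L0_bar M\<^esub> (f ` G) = \<Squnion>\<^bsub>L0_bar M\<^esub> (f ` Hcc M E G)"
      by (simp add: Lattice.sup_def Upper_image_Hcc[OF cc])
  next
    fix f g G
    assume f: "f \<in> carrier E \<rightarrow> carrier (L0_bar M)" "local_property M E f"
      and g: "g \<in> carrier E \<rightarrow> carrier (L0_bar M)" "local_property M E g"
      and G: "G \<subseteq> carrier E" and eq: "\<forall>x\<in>G. f x = g x"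
    show "\<forall>x\<in>Hcc M E G. f x = g x"
    proof
      fix x assume "x \<in> Hcc M E G"
      then obtain A xs where x: "x = concat_module M E A xs"
        and A: "countable_partition M A" and xs: "range xs \<subseteq> G"
        by (auto simp: Hcc_def)
      have xsE: "range xs \<subseteq> carrier E" using xs G by blast
      \<comment> \<open>The sequence \<open>xs\<close> stays in \<open>G\<close>, where
        \<open>f\<close> and \<open>g\<close> coincide, so both values at \<open>x\<close> are the
        same \<open>concat_bar\<close>.\<close>
      have "(\<lambda>n. f (xs n)) = (\<lambda>n. g (xs n))" using eq xs by (auto simp: image_subset_iff)
      then show "f x = g x"
        unfolding x local_concat_module(2)[OF cc f A xsE] local_concat_module(2)[OF cc g A xsE]
        by simp
    qed
  next
    fix \<Gamma> :: "'i set" and F f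
    assume F: "\<forall>\<alpha>\<in>\<Gamma>. F \<alpha> \<in> carrier E \<rightarrow> carrier (L0_bar M) \<and> local_property M E (F \<alpha>)"
      and f: "\<forall>x\<in>carrier E. f x = \<Squnion>\<^bsub>L0_bar M\<^esub> {F \<alpha> x | \<alpha>. \<alpha> \<in> \<Gamma>}"
    \<comment> \<open>The set comprehension is rewritten as an image over \<Gamma>, the indexed form
      in which suprema were compared.\<close>
    have f': "f x = \<Squnion>\<^bsub>L0_bar M\<^esub> ((\<lambda>\<alpha>. F \<alpha> x) ` \<Gamma>)" if "x \<in> carrier E" for x
      using f that by (simp add: image_def Bex_def conj_commute)
    show "f \<in> carrier E \<rightarrow> carrier (L0_bar M)" "local_property M E f"
      by (rule local_property_sup[of \<Gamma> F]; use F f' in blast)+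
  qed
qed

end
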